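(* For all integers $k\ge 2$, $\operatorname{Cliff}(Alt(2^k))$ is an Abelian subgroup of order $2^k$ of the alternating group $Alt(2^k)\subset\mathcal{S}_{2^k}$.
   Context: $\mathcal{S}_{2^k}$ is the symmetric group on $\{1,\dots,2^k\}$ and $Alt(2^k)$ its alternating subgroup. For $0\le j\le k-1$, divide $\{1,\dots,2^k\}$ into $2^{k-j}$ consecutive blocks of size $2^j$; the switch permutation $A_{2^j}\in\mathcal{S}_{2^k}$ interchanges the first and second blocks, the third and fourth blocks, ..., the $(2^{k-j}-1)$th and $(2^{k-j})$th blocks, preserving the order of the numbers within each block. $(1)$ denotes the identity permutation. $S_{1,\dots,k}$ denotes any permutation of the form $S_k\circ\cdots\circ S_1$ where $S_l\in\{(1),A_{2^{l-1}}\}$ for $1\le l\le k$ (these are called strictly real induced Clifford permutations). $\operatorname{Cliff}(Alt(2^k))$ is the set of all permutations of the form $S_{1,\dots,k}$. *)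

theory Defs
  imports "HOL-Algebra.Sym_Groups"
begin

(* switch_perm k j is A_{2^j} in S_{2^k}.  The consecutive block of size 2^j containing
   x >= 1 has the 0-based number (x - 1) div 2^j, so the first, third, ... blocks are those
   of even number; they move up by one block and the others move down by one block.
   Points outside {1..2^k} are fixed, as "permutes" requires. *)
definition switch_perm :: "nat \<Rightarrow> nat \<Rightarrow> nat \<Rightarrow> nat" where
  "switch_perm k j x =
     (if x \<in> {1..2 ^ k}
      then if even ((x - 1) div 2 ^ j) then x + 2 ^ j else x - 2 ^ j
      else x)"

(* fold S [1..<Suc k] unfolds to S k o ... o S 1. *)
definition Cliff_Alt :: "nat \<Rightarrow> (nat \<Rightarrow> nat) set" where
  "Cliff_Alt k =
     {fold S [1..<Suc k] | S :: nat \<Rightarrow> nat \<Rightarrow> nat.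
        \<forall>l\<in>{1..k}. S l \<in> {id, switch_perm k (l - 1)}}"

end

theory Submission
  imports Defs
begin

text \<open>
  After shifting labels to \<open>{0..<2^k}\<close>, the switch of level \<open>j\<close> flips the \<open>j\<close>-th binary digit, so
  the products of switches are exactly the translations \<open>x \<mapsto> x XOR m\<close> with \<open>m < 2^k\<close>. These form a
  copy of the elementary Abelian group of order \<open>2^k\<close>. For evenness, choose a digit \<open>i \<noteq> j\<close> (this
  needs \<open>k \<ge> 2\<close>) and split the switch of level \<open>j\<close> into the part acting on numbers with \<open>i\<close>-th digit
  1 and the part acting on the others: the switch of level \<open>i\<close> conjugates one into the other, so
  both have the same sign.
\<close>

unbundle bit_operations_syntax

lemma xor_left_self:
  fixes a b :: nat
  shows "a XOR a XOR b = b"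
  by (simp flip: xor.assoc)

lemma xor_less_two_power:
  fixes a b :: nat
  assumes "a < 2 ^ k" "b < 2 ^ k"
  shows "a XOR b < 2 ^ k"
  using assms by (simp flip: take_bit_nat_eq_self_iff)

text \<open>Splits off the top digit, so that inductions on the number of low digits add one switch
  at a time.\<close>

lemma take_bit_Suc_xor:
  fixes m :: nat
  shows "take_bit (Suc n) m = (if bit m n then 2 ^ n XOR take_bit n m else take_bit n m)"
  by (rule bit_eqI) (auto simp: bit_take_bit_iff bit_xor_iff bit_exp_iff less_Suc_eq)

text \<open>The predicate \<open>P\<close> allows both full translations (\<open>P\<close>
  constantly true) and the half-switches of the sign argument.\<close>

definition partial_xor_perm :: "nat \<Rightarrow> (nat \<Rightarrow> bool) \<Rightarrow> nat \<Rightarrow> nat \<Rightarrow> nat" where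
  "partial_xor_perm k P m x =
     (if x \<in> {1..2 ^ k} \<and> P (x - 1) then Suc ((x - 1) XOR m) else x)"

abbreviation xor_perm :: "nat \<Rightarrow> nat \<Rightarrow> nat \<Rightarrow> nat" where
  "xor_perm k \<equiv> partial_xor_perm k (\<lambda>_. True)"

lemma partial_xor_perm_Suc:
  "a < 2 ^ k \<Longrightarrow> partial_xor_perm k P m (Suc a) = (if P a then Suc (a XOR m) else Suc a)"
  by (simp add: partial_xor_perm_def)

lemma partial_xor_perm_outside:
  "x \<notin> {1..2 ^ k} \<Longrightarrow> partial_xor_perm k P m x = x"
  by (auto simp add: partial_xor_perm_def)

text \<open>Moves equality proofs to 0-based labels, where \<open>partial_xor_perm_Suc\<close>
  evaluates without subtraction.\<close>

lemma eq_on_Suc_less_imp_eq: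
  fixes f g :: "nat \<Rightarrow> nat"
  assumes "\<And>a. a < n \<Longrightarrow> f (Suc a) = g (Suc a)"
    and "\<And>x. x \<notin> {1..n} \<Longrightarrow> f x = g x"
  shows "f = g"
proof
  fix x
  show "f x = g x"
  proof (cases "x \<in> {1..n}")
    case True
    then have "x = Suc (x - 1)" "x - 1 < n" by auto
    then show ?thesis using assms(1) by metis
  qed (rule assms(2))
qed

text \<open>Invariance of \<open>P\<close> ensures that a moved point is moved again, and the bound
  on \<open>m\<close> keeps it in range; the two XORs then cancel.\<close>

lemma partial_xor_perm_involution:
  assumes "m < 2 ^ k" "\<And>a. P (a XOR m) = P a"
  shows "partial_xor_perm k P m \<circ> partial_xor_perm k P m = id"
  by (rule eq_on_Suc_less_imp_eq[where n = "2 ^ k"])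
    (use assms in \<open>auto simp: partial_xor_perm_Suc partial_xor_perm_outside xor_less_two_power
       xor.assoc\<close>)

lemma partial_xor_perm_permutes:
  assumes "m < 2 ^ k" "\<And>a. P (a XOR m) = P a"
  shows "partial_xor_perm k P m permutes {1..2 ^ k}"
proof -
  have "partial_xor_perm k P m (partial_xor_perm k P m x) = x" for x
    using partial_xor_perm_involution[of m k P] assms by (metis comp_apply id_apply)
  then show ?thesis
    unfolding permutes_def by (metis partial_xor_perm_outside)
qed

lemma xor_perm_comp:
  assumes "m < 2 ^ k" "n < 2 ^ k"
  shows "xor_perm k m \<circ> xor_perm k n = xor_perm k (m XOR n)"
  by (rule eq_on_Suc_less_imp_eq[where n = "2 ^ k"])
    (use assms in \<open>auto simp: partial_xor_perm_Suc partial_xor_perm_outside xor_less_two_power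
       ac_simps\<close>)

lemma xor_perm_0: "xor_perm k 0 = id"
  by (auto simp: partial_xor_perm_def)

text \<open>The parity of \<open>a div 2 ^ j\<close> is digit \<open>j\<close> of \<open>a\<close>,
  so adding or subtracting \<open>2 ^ j\<close> accordingly flips that digit without a carry or
  borrow.\<close>

lemma switch_perm_eq_xor_perm: "switch_perm k j = xor_perm k (2 ^ j)"
proof (rule eq_on_Suc_less_imp_eq[where n = "2 ^ k"])
  fix a :: nat
  assume a: "a < 2 ^ k"
  have "a XOR 2 ^ j = flip_bit j a"
    by (simp add: flip_bit_eq_xor)
  also have "\<dots> = (if bit a j then a - 2 ^ j else a + 2 ^ j)"
  proof (cases "bit a j")
    case True
    then have "a = set_bit j (unset_bit j a)"
      by (intro bit_eqI) (auto simp: bit_set_bit_iff bit_unset_bit_iff)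
    also have "\<dots> = unset_bit j a + 2 ^ j"
      by (simp add: set_bit_eq bit_unset_bit_iff)
    finally have "unset_bit j a = a - 2 ^ j" by linarith
    with True show ?thesis by (simp add: flip_bit_eq_if)
  qed (simp add: flip_bit_eq_if set_bit_eq)
  also have "\<dots> = (if even (a div 2 ^ j) then a + 2 ^ j else a - 2 ^ j)"
    by (simp add: bit_iff_odd)
  finally have "a XOR 2 ^ j = (if even (a div 2 ^ j) then a + 2 ^ j else a - 2 ^ j)" .
  \<comment> \<open>Subtraction on naturals truncates; this bound gives
    \<open>Suc a - 2 ^ j = Suc (a - 2 ^ j)\<close>.\<close>
  moreover have "2 ^ j \<le> a" if "odd (a div 2 ^ j)"
    using that by (metis div_less even_zero not_le)
  ultimately show "switch_perm k j (Suc a) = xor_perm k (2 ^ j) (Suc a)"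
    using a by (auto simp: switch_perm_def partial_xor_perm_Suc Suc_diff_le)
qed (auto simp: switch_perm_def partial_xor_perm_outside)

text \<open>The sign of \<open>q\<close> enters twice and cancels.\<close>

lemma evenperm_sandwich:
  assumes "permutation p" "permutation q"
  shows "evenperm (q \<circ> p \<circ> q) = evenperm p"
  using assms by (auto simp: evenperm_comp permutation_compose)

lemma evenperm_xor_perm_two_power:
  assumes "k \<ge> 2" "j < k"
  shows "evenperm (xor_perm k (2 ^ j))"
proof -
  \<comment> \<open>Digit 1 serves if \<open>j = 0\<close>, and digit 0 otherwise.\<close>
  obtain i where i: "i < k" "i \<noteq> j"
    using assms that[of 0] that[of 1] by (cases "j = 0") auto
  define P where "P = (\<lambda>a::nat. bit a i)"
  let ?p = "partial_xor_perm k P (2 ^ j)"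
  let ?p' = "partial_xor_perm k (\<lambda>a. \<not> P a) (2 ^ j)"
  let ?q = "xor_perm k (2 ^ i)"
  have less: "(2::nat) ^ j < 2 ^ k" "(2::nat) ^ i < 2 ^ k"
    using assms i by auto
  \<comment> \<open>Flipping digit \<open>j\<close> preserves each half, so both parts are
    permutations; flipping digit \<open>i\<close> exchanges the halves.\<close>
  have Pj: "P (a XOR 2 ^ j) = P a" and Pi: "P (a XOR 2 ^ i) = (\<not> P a)" for a
    using i by (auto simp: P_def bit_xor_iff bit_exp_iff)
  have perm: "permutation ?p" "permutation ?p'" "permutation ?q"
    by (auto intro!: permutes_imp_permutation[of "{1..2 ^ k}"] partial_xor_perm_permutes
        simp: less Pj)
  have "xor_perm k (2 ^ j) = ?p \<circ> ?p'"
    by (rule eq_on_Suc_less_imp_eq[where n = "2 ^ k"])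
      (auto simp: partial_xor_perm_Suc partial_xor_perm_outside xor_less_two_power less Pj)
  moreover have "?p' = ?q \<circ> ?p \<circ> ?q"
    by (rule eq_on_Suc_less_imp_eq[where n = "2 ^ k"])
      (auto simp: partial_xor_perm_Suc partial_xor_perm_outside xor_less_two_power less Pi
        xor_left_self ac_simps)
  ultimately show ?thesis
    using evenperm_comp[OF perm(1,2)] evenperm_sandwich[OF perm(1,3)] by simp
qed

lemma fold_upt_Suc_right:
  "fold S [1..<Suc (Suc n)] = S (Suc n) \<circ> fold S [1..<Suc n]"
proof -
  have "[1..<Suc (Suc n)] = [1..<Suc n] @ [Suc n]"
    by (rule upt_Suc_append) simp
  then show ?thesis
    by (simp only: fold_append fold.simps o_id id_o)
qed

text \<open>The bound \<open>2 ^ n\<close> records that the first \<open>n\<close> factors touch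
  only digits below \<open>n\<close>; the case \<open>n = k\<close> gives one inclusion for
  \<open>Cliff_Alt\<close>.\<close>

lemma fold_switches_is_xor_perm:
  assumes "n \<le> k" "\<forall>l\<in>{1..n}. S l \<in> {id, switch_perm k (l - 1)}"
  shows "\<exists>m < 2 ^ n. fold S [1..<Suc n] = xor_perm k m"
  using assms
proof (induction n)
  case 0
  then show ?case by (auto simp: xor_perm_0)
next
  case (Suc n)
  then obtain m where m: "m < 2 ^ n" "fold S [1..<Suc n] = xor_perm k m"
    by auto
  have *: "fold S [1..<Suc (Suc n)] = S (Suc n) \<circ> xor_perm k m"
    by (simp only: fold_upt_Suc_right m(2))
  have less: "2 ^ n < (2::nat) ^ k" "m < 2 ^ k"
    using Suc.prems(1) m(1) less_le_trans[OF m(1), of "2 ^ k"] by auto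
  have "S (Suc n) \<in> {id, switch_perm k (Suc n - 1)}"
    using Suc.prems(2) by (rule bspec) simp
  then consider "S (Suc n) = id" | "S (Suc n) = xor_perm k (2 ^ n)"
    by (auto simp only: switch_perm_eq_xor_perm diff_Suc_1)
  then show ?case
  proof cases
    case 1
    then show ?thesis using * m(1) by (intro exI[of _ m]) auto
  next
    case 2
    then have "fold S [1..<Suc (Suc n)] = xor_perm k (2 ^ n XOR m)"
      using * less by (simp add: xor_perm_comp)
    moreover have "2 ^ n XOR m < 2 ^ Suc n"
      using m(1) by (intro xor_less_two_power) auto
    ultimately show ?thesis by blast
  qed
qed

text \<open>Gives the converse inclusion: the binary digits of \<open>m\<close> dictate which
  switches to apply.\<close>

lemma fold_binary_digit_switches:
  assumes "n \<le> k"
  shows "fold (\<lambda>l. if bit m (l - 1) then switch_perm k (l - 1) else id) [1..<Suc n] =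
    xor_perm k (take_bit n m)"
  using assms
proof (induction n)
  case 0
  then show ?case by (simp add: xor_perm_0 id_def)
next
  case (Suc n)
  have less: "2 ^ n < (2::nat) ^ k" "take_bit n m < 2 ^ k"
    using Suc.prems less_le_trans[OF take_bit_nat_less_exp[of n m], of "2 ^ k"] by auto
  let ?S = "\<lambda>l. if bit m (l - 1) then switch_perm k (l - 1) else id"
  have "fold ?S [1..<Suc (Suc n)] = ?S (Suc n) \<circ> xor_perm k (take_bit n m)"
    using Suc by (simp only: fold_upt_Suc_right Suc_leD)
  also have "\<dots> = xor_perm k (take_bit (Suc n) m)"
    using xor_perm_comp[OF less] by (simp add: take_bit_Suc_xor switch_perm_eq_xor_perm)
  finally show ?case .
qed

lemma Cliff_Alt_eq: "Cliff_Alt k = xor_perm k ` {..<2 ^ k}"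
proof
  show "Cliff_Alt k \<subseteq> xor_perm k ` {..<2 ^ k}"
    unfolding Cliff_Alt_def using fold_switches_is_xor_perm[of k k] by blast
  show "xor_perm k ` {..<2 ^ k} \<subseteq> Cliff_Alt k"
  proof clarsimp
    fix m :: nat
    assume "m < 2 ^ k"
    then have "xor_perm k m =
        fold (\<lambda>l. if bit m (l - 1) then switch_perm k (l - 1) else id) [1..<Suc k]"
      using fold_binary_digit_switches[of k k m] by (simp only: take_bit_nat_eq_self)
    moreover have "fold (\<lambda>l. if bit m (l - 1) then switch_perm k (l - 1) else id) [1..<Suc k]
        \<in> Cliff_Alt k"
      unfolding Cliff_Alt_def by (intro CollectI exI conjI, rule refl) simp
    ultimately show "xor_perm k m \<in> Cliff_Alt k"
      by (simp only:)
  qed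
qed

text \<open>The image of label 1, which is 0 after the shift, is \<open>Suc m\<close> and so reveals
  \<open>m\<close>.\<close>

lemma inj_on_xor_perm: "inj_on (xor_perm k) {..<2 ^ k}"
proof (rule inj_onI)
  fix m n assume "xor_perm k m = xor_perm k n"
  then have "xor_perm k m (Suc 0) = xor_perm k n (Suc 0)" by simp
  then show "m = n" by (simp add: partial_xor_perm_Suc)
qed

lemma evenperm_xor_perm:
  assumes "k \<ge> 2" "m < 2 ^ k"
  shows "evenperm (xor_perm k m)"
proof -
  have "evenperm (xor_perm k (take_bit n m))" if "n \<le> k" for n
    using that
  proof (induction n)
    case 0
    then show ?case by (simp add: xor_perm_0)
  next
    case (Suc n)
    have less: "2 ^ n < (2::nat) ^ k" "take_bit n m < 2 ^ k"
      using Suc.prems less_le_trans[OF take_bit_nat_less_exp[of n m], of "2 ^ k"] by auto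
    have perm: "permutation (xor_perm k (2 ^ n))" "permutation (xor_perm k (take_bit n m))"
      by (auto intro!: permutes_imp_permutation[of "{1..2 ^ k}"] partial_xor_perm_permutes less)
    from Suc show ?case
      using less perm assms evenperm_xor_perm_two_power[of k n]
      \<comment> \<open>The flipped rule turns the XOR with \<open>2 ^ n\<close> back into a
        composition of two even permutations.\<close>
      by (auto simp: take_bit_Suc_xor evenperm_comp simp flip: xor_perm_comp)
  qed
  from this[of k] assms(2) show ?thesis by (simp add: take_bit_nat_eq_self)
qed

theorem proposition5p5:
  fixes k :: nat
  assumes "k \<ge> 2"
  shows "subgroup (Cliff_Alt k) (alt_group (2 ^ k))
       \<and> comm_group (alt_group (2 ^ k) \<lparr>carrier := Cliff_Alt k\<rparr>)
       \<and> order (alt_group (2 ^ k) \<lparr>carrier := Cliff_Alt k\<rparr>) = 2 ^ k"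
proof -
  let ?G = "alt_group (2 ^ k)"
  interpret G: group ?G by (rule alt_group_is_group)
  have sub: "Cliff_Alt k \<subseteq> carrier ?G"
    by (auto simp: Cliff_Alt_eq alt_group_def evenperm_xor_perm assms
        intro!: partial_xor_perm_permutes simp del: One_nat_def)
  have mult: "p \<otimes>\<^bsub>?G\<^esub> q = p \<circ> q" for p q
    by (simp add: alt_group_mult)
  have closed: "p \<circ> q \<in> Cliff_Alt k" if "p \<in> Cliff_Alt k" "q \<in> Cliff_Alt k" for p q
    using that by (auto simp: Cliff_Alt_eq xor_perm_comp xor_less_two_power)
  have comm: "p \<circ> q = q \<circ> p" if "p \<in> Cliff_Alt k" "q \<in> Cliff_Alt k" for p q
    using that by (auto simp: Cliff_Alt_eq xor_perm_comp xor.commute)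
  \<comment> \<open>Translations by XOR are involutions, which makes closure under inverses
    immediate.\<close>
  have inv: "inv\<^bsub>?G\<^esub> p = p" if p: "p \<in> Cliff_Alt k" for p
  proof (rule G.inv_equality)
    show "p \<otimes>\<^bsub>?G\<^esub> p = \<one>\<^bsub>?G\<^esub>"
      using p by (auto simp: Cliff_Alt_eq mult alt_group_one partial_xor_perm_involution)
  qed (use p sub in auto)
  have "id \<in> Cliff_Alt k"
    unfolding Cliff_Alt_eq by (rule image_eqI[of _ _ 0]) (auto simp: xor_perm_0)
  then have subgroup: "subgroup (Cliff_Alt k) ?G"
    using sub closed inv by (intro G.subgroupI) (auto simp: mult)
  then have "group (?G \<lparr>carrier := Cliff_Alt k\<rparr>)"
    by (rule G.subgroup_imp_group)
  then have "comm_group (?G \<lparr>carrier := Cliff_Alt k\<rparr>)"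
    by (rule group.group_comm_groupI) (use comm in \<open>auto simp: mult\<close>)
  moreover have "order (?G \<lparr>carrier := Cliff_Alt k\<rparr>) = 2 ^ k"
    by (simp add: order_def Cliff_Alt_eq card_image inj_on_xor_perm)
  ultimately show ?thesis using subgroup by blast
qed

end
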